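(* Let $\alpha>0$, $\beta>-1$, $\sigma>0$, and let $F$ be the CDF of the $MLM(\alpha,\beta,\sigma)$ distribution. Then $F$ is a function with regularly varying tails and it belongs to the maximum domain of attraction of the Fréchet distribution with index $\alpha$; that is, for every $t>0$, $$\lim_{x\to\infty}\frac{1-F(tx)}{1-F(x)}=t^{-\alpha}.$$
   Context: For $\alpha>0$, $\beta>-1$, $\sigma>0$, the modified Lomax distribution $MLM(\alpha,\beta,\sigma)$ has CDF $$F(x)=1-\exp\left[-\alpha\,\frac{\left(\log(1+x/\sigma)\right)^{\beta+1}}{\left(1+\log(1+x/\sigma)\right)^{\beta}}\right]\quad (x>0),\qquad F(x)=0\quad (x\le 0).$$ Definition used: a distribution function $F$ is said to have regularly varying tails with tail index $\alpha>0$, and to belong to the maximum domain of attraction of the Fréchet distribution with index $\alpha$, if for every $t>0$, $\lim_{x\to\infty}\frac{1-F(tx)}{1-F(x)}=t^{-\alpha}$. *)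

theory Defs
  imports "HOL-Probability.Probability"
begin

definition distribution_function :: "(real \<Rightarrow> real) \<Rightarrow> bool" where
  "distribution_function F \<longleftrightarrow> (\<exists>M. real_distribution M \<and> F = cdf M)"

text \<open>The base of each real power below is positive for \<open>x > 0\<close> and \<open>\<sigma> > 0\<close>, where \<open>powr\<close>
  is the usual real power.\<close>

definition mlm_cdf :: "real \<Rightarrow> real \<Rightarrow> real \<Rightarrow> real \<Rightarrow> real" where
  "mlm_cdf \<alpha> \<beta> \<sigma> x =
     (if x > 0
      then 1 - exp (- (\<alpha> * (ln (1 + x / \<sigma>) powr (\<beta> + 1) / (1 + ln (1 + x / \<sigma>)) powr \<beta>)))
      else 0)"

definition regularly_varying_tails :: "real \<Rightarrow> (real \<Rightarrow> real) \<Rightarrow> bool" where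
  "regularly_varying_tails \<alpha> F \<longleftrightarrow>
     \<alpha> > 0 \<and> distribution_function F \<and>
     (\<forall>t>0. ((\<lambda>x. (1 - F (t * x)) / (1 - F x)) \<longlongrightarrow> t powr (- \<alpha>)) at_top)"

text \<open>Following the convention of the source, membership in the maximum domain of attraction of
  the Frechet distribution is defined by the tail condition itself, not by weak convergence
  of normalised maxima.\<close>

definition frechet_mda :: "real \<Rightarrow> (real \<Rightarrow> real) \<Rightarrow> bool" where
  "frechet_mda \<alpha> F \<longleftrightarrow>
     \<alpha> > 0 \<and> distribution_function F \<and>
     (\<forall>t>0. ((\<lambda>x. (1 - F (t * x)) / (1 - F x)) \<longlongrightarrow> t powr (- \<alpha>)) at_top)"

end

theory Submission
  imports Defs "HOL-Real_Asymp.Real_Asymp"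
begin

text \<open>With \<open>g u = u powr (\<beta> + 1) / (1 + u) powr \<beta>\<close> and \<open>L x = ln (1 + x / \<sigma>)\<close> the tail is
  \<open>exp (- \<alpha> * g (L x))\<close>. As \<open>u\<close> tends to infinity, \<open>g u - u\<close> converges (to \<open>- \<beta>\<close>), hence
  \<open>g (L (t * x)) - g (L x)\<close> has the same limit as \<open>L (t * x) - L x\<close>, which is \<open>ln t\<close>.\<close>

definition mlm_exponent :: "real \<Rightarrow> real \<Rightarrow> real" where
  "mlm_exponent \<beta> u = u powr (\<beta> + 1) / (1 + u) powr \<beta>"

lemma mlm_exponent_0 [simp]: "mlm_exponent \<beta> 0 = 0"
  by (simp add: mlm_exponent_def)

text \<open>In either sign case the exponent is a product of nonnegative nondecreasing factors:
  \<open>w\<close> and \<open>(w / (1 + w)) powr \<beta>\<close> if \<beta> \<ge> 0, otherwise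
  \<open>w powr (\<beta> + 1)\<close> and \<open>(1 + w) powr (- \<beta>)\<close>, whose powers are
  both positive.\<close>

lemma mlm_exponent_mono:
  assumes "\<beta> > -1" "0 \<le> u" "u \<le> v"
  shows "mlm_exponent \<beta> u \<le> mlm_exponent \<beta> v"
proof (cases "u = 0")
  case True
  then show ?thesis using assms by (simp add: mlm_exponent_def)
next
  case False
  with assms have u: "u > 0" by simp
  show ?thesis
  proof (cases "\<beta> \<ge> 0")
    case True
    have eq: "mlm_exponent \<beta> w = w * (w / (1 + w)) powr \<beta>" if "w > 0" for w
      using that by (simp add: mlm_exponent_def powr_add powr_divide)
    have "u / (1 + u) \<le> v / (1 + v)"
      using assms u by (simp add: field_simps)
    then have "(u / (1 + u)) powr \<beta> \<le> (v / (1 + v)) powr \<beta>"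
      using True u by (intro powr_mono2) auto
    then show ?thesis
      using assms u by (simp add: eq mult_mono)
  next
    case False
    have "mlm_exponent \<beta> w = w powr (\<beta> + 1) * (1 + w) powr (- \<beta>)" for w
      by (simp add: mlm_exponent_def powr_minus divide_inverse)
    then show ?thesis
      using assms False u by (auto intro!: mult_mono powr_mono2)
  qed
qed

text \<open>The delicate point is 0, where the base \<open>u\<close> vanishes; there
  \<open>\<beta> + 1 > 0\<close> secures continuity of the numerator.\<close>

lemma continuous_on_mlm_exponent:
  assumes "\<beta> > -1"
  shows "continuous_on {0..} (mlm_exponent \<beta>)"
  unfolding mlm_exponent_def using assms
  by (intro continuous_intros continuous_on_powr') auto

text \<open>For \<open>u > 0\<close> the exponent equals
  \<open>u * (1 + 1 / u) powr (- \<beta>)\<close>, which expands as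
  \<open>u - \<beta> + O(1 / u)\<close>.\<close>

lemma mlm_exponent_minus_id_tendsto:
  "((\<lambda>u. mlm_exponent \<beta> u - u) \<longlongrightarrow> - \<beta>) at_top"
  unfolding mlm_exponent_def by real_asymp

lemma mlm_exponent_at_top: "filterlim (mlm_exponent \<beta>) at_top at_top"
  using filterlim_tendsto_add_at_top[OF mlm_exponent_minus_id_tendsto filterlim_ident]
  by simp

text \<open>Clamping \<open>x\<close> at 0 merges the two branches, as the exponent vanishes at 0.
  Monotonicity and continuity then need no separate treatment of the origin.\<close>

lemma mlm_cdf_eq:
  assumes "\<sigma> > 0"
  shows "mlm_cdf \<alpha> \<beta> \<sigma> x = 1 - exp (- (\<alpha> * mlm_exponent \<beta> (ln (1 + max 0 x / \<sigma>))))"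
  using assms by (auto simp: mlm_cdf_def mlm_exponent_def max_def)

text \<open>The witness is the Lebesgue-Stieltjes measure of the function, available once
  monotonicity, right-continuity and the limits 0 and 1 are established.\<close>

lemma distribution_function_mlm_cdf:
  assumes "\<alpha> > 0" "\<beta> > -1" "\<sigma> > 0"
  shows "distribution_function (mlm_cdf \<alpha> \<beta> \<sigma>)"
proof -
  let ?F = "mlm_cdf \<alpha> \<beta> \<sigma>"
  have mono: "?F x \<le> ?F y" if "x \<le> y" for x y
  proof -
    have "ln (1 + max 0 x / \<sigma>) \<le> ln (1 + max 0 y / \<sigma>)"
      using that assms by (subst ln_le_cancel_iff) (auto simp: divide_right_mono add_pos_nonneg)
    then show ?thesis
      unfolding mlm_cdf_eq[OF assms(3)] using assms
      by (auto intro!: mult_left_mono mlm_exponent_mono)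
  qed
  have "1 + max 0 x / \<sigma> > 0" for x
    using assms by (simp add: add_pos_nonneg)
  then have "continuous_on UNIV (\<lambda>x. ln (1 + max 0 x / \<sigma>))"
    using assms by (intro continuous_intros) (auto simp: less_imp_neq[symmetric])
  then have "continuous_on UNIV (\<lambda>x. mlm_exponent \<beta> (ln (1 + max 0 x / \<sigma>)))"
    by (rule continuous_on_compose2[OF continuous_on_mlm_exponent[OF assms(2)]]) (use assms in auto)
  then have "continuous_on UNIV ?F"
    unfolding mlm_cdf_eq[OF assms(3), abs_def] by (intro continuous_intros)
  then have cont: "continuous (at_right a) ?F" for a
    using continuous_on_eq_continuous_at continuous_at_imp_continuous_at_within by blast
  have bot: "(?F \<longlongrightarrow> 0) at_bot"
  proof (rule tendsto_eventually)
    show "\<forall>\<^sub>F x in at_bot. ?F x = 0"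
      using eventually_le_at_bot[of 0] by eventually_elim (simp add: mlm_cdf_def)
  qed
  have "filterlim (\<lambda>x. ln (1 + max 0 x / \<sigma>)) at_top at_top"
    using assms by real_asymp
  then have "filterlim (\<lambda>x. mlm_exponent \<beta> (ln (1 + max 0 x / \<sigma>))) at_top at_top"
    by (rule filterlim_compose[OF mlm_exponent_at_top])
  moreover have "((\<lambda>y. 1 - exp (- (\<alpha> * y))) \<longlongrightarrow> 1) at_top"
    using assms by real_asymp
  ultimately have top: "(?F \<longlongrightarrow> 1) at_top"
    unfolding mlm_cdf_eq[OF assms(3), abs_def] by (rule filterlim_compose[rotated])
  show ?thesis
    unfolding distribution_function_def
  proof (intro exI conjI)
    show "real_distribution (interval_measure ?F)"
      by (rule real_distribution_interval_measure[OF mono cont bot top])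
    show "?F = cdf (interval_measure ?F)"
      by (rule cdf_interval_measure[OF mono cont bot, symmetric])
  qed
qed

lemma mlm_cdf_tail_ratio_tendsto:
  assumes "\<sigma> > 0" "t > 0"
  shows "((\<lambda>x. (1 - mlm_cdf \<alpha> \<beta> \<sigma> (t * x)) / (1 - mlm_cdf \<alpha> \<beta> \<sigma> x)) \<longlongrightarrow> t powr (- \<alpha>)) at_top"
proof -
  let ?L = "\<lambda>x. ln (1 + x / \<sigma>)" and ?g = "mlm_exponent \<beta>"
  have "filterlim ?L at_top at_top" "filterlim (\<lambda>x. ?L (t * x)) at_top at_top"
    using assms by real_asymp+
  note this[THEN filterlim_compose[OF mlm_exponent_minus_id_tendsto[of \<beta>]]]
  moreover have "((\<lambda>x. ?L (t * x) - ?L x) \<longlongrightarrow> ln t) at_top"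
    using assms by real_asymp (simp add: ln_mult)
  \<comment> \<open>Each bracket has a finite limit, although \<open>?g\<close> and
    \<open>?L\<close> diverge separately. The \<open>?L\<close> terms cancel, leaving the difference
    of the two exponents with limit \<open>ln t\<close>.\<close>
  ultimately have "((\<lambda>x. (?g (?L (t * x)) - ?L (t * x)) - (?g (?L x) - ?L x)
      + (?L (t * x) - ?L x)) \<longlongrightarrow> - \<beta> - - \<beta> + ln t) at_top"
    by (intro tendsto_intros)
  then have "((\<lambda>x. exp (- \<alpha> * (?g (?L (t * x)) - ?g (?L x)))) \<longlongrightarrow> exp (- \<alpha> * ln t)) at_top"
    by (intro tendsto_intros) (simp add: algebra_simps)
  \<comment> \<open>Once \<open>x > 0\<close>, also \<open>t * x > 0\<close>, so the clamping
    disappears and the quotient of tails is a quotient of exponentials.\<close>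
  moreover have "\<forall>\<^sub>F x in at_top. exp (- \<alpha> * (?g (?L (t * x)) - ?g (?L x))) =
      (1 - mlm_cdf \<alpha> \<beta> \<sigma> (t * x)) / (1 - mlm_cdf \<alpha> \<beta> \<sigma> x)"
    using eventually_gt_at_top[of 0]
  proof eventually_elim
    case (elim x)
    then show ?case
      using assms by (simp add: mlm_cdf_eq max_def flip: exp_diff) (simp add: algebra_simps)
  qed
  ultimately show ?thesis
    using assms by (simp add: powr_def tendsto_cong)
qed

theorem theorem3:
  fixes \<alpha> \<beta> \<sigma> :: real and F :: "real \<Rightarrow> real"
  assumes "\<alpha> > 0" and "\<beta> > -1" and "\<sigma> > 0"
    and "F = mlm_cdf \<alpha> \<beta> \<sigma>"
  shows "regularly_varying_tails \<alpha> F \<and> frechet_mda \<alpha> F \<and>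
    (\<forall>t>0. ((\<lambda>x. (1 - F (t * x)) / (1 - F x)) \<longlongrightarrow> t powr (- \<alpha>)) at_top)"
  unfolding regularly_varying_tails_def frechet_mda_def assms(4)
  using distribution_function_mlm_cdf[OF assms(1-3)] mlm_cdf_tail_ratio_tendsto[OF assms(3)] assms(1)
  by blast

end
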